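(* Let $ABC$ be a triangle, and let $\mathcal{K}$ be the Darboux cubic of the Euler triangle of $ABC$. Then $\mathcal{K}$ passes through the circumcenter of $ABC$, the orthocenter of $ABC$, the Euler center (nine-point center) of $ABC$, the midpoint of the segment joining the incenter and the orthocenter of $ABC$, the vertices of the Euler triangle of $ABC$, and the midpoints of the sides of $ABC$.
   Context: The Euler triangle of $ABC$ is the triangle whose vertices are the intersection points of the altitudes with the nine-point circle (other than the feet of the altitudes), i.e. the midpoints of the segments joining the vertices $A,B,C$ to the orthocenter. The Darboux cubic of a triangle is the cubic curve passing through its vertices, its excenters, its incenter, its circumcenter and its Bevan point (it is the locus of points $P$ such that $P$, its isogonal conjugate, and the de Longchamps point are collinear). The Bevan point of a triangle is the circumcenter of its excentral triangle (the triangle of its excenters); the de Longchamps point is the reflection of the orthocenter in the circumcenter. *)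

theory Defs
  imports "HOL-Analysis.Analysis"
begin

text \<open>The Euclidean plane is modelled by the type \<^typ>\<open>complex\<close>. The centres below are
  specified by their defining property and are meaningful for non-collinear vertices.\<close>

definition circumcenter :: "complex \<Rightarrow> complex \<Rightarrow> complex \<Rightarrow> complex" where
  "circumcenter A B C = (THE P. dist P A = dist P B \<and> dist P B = dist P C)"

definition orthocenter :: "complex \<Rightarrow> complex \<Rightarrow> complex \<Rightarrow> complex" where
  "orthocenter A B C =
     (THE P. (P - A) \<bullet> (B - C) = 0 \<and> (P - B) \<bullet> (C - A) = 0 \<and> (P - C) \<bullet> (A - B) = 0)"

definition nine_point_center :: "complex \<Rightarrow> complex \<Rightarrow> complex \<Rightarrow> complex" where
  "nine_point_center A B C = circumcenter (midpoint B C) (midpoint C A) (midpoint A B)"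

definition de_longchamps_point :: "complex \<Rightarrow> complex \<Rightarrow> complex \<Rightarrow> complex" where
  "de_longchamps_point A B C = 2 * circumcenter A B C - orthocenter A B C"

text \<open>Direction of the internal bisector of the angle at the first argument.\<close>

definition bisector_dir :: "complex \<Rightarrow> complex \<Rightarrow> complex \<Rightarrow> complex" where
  "bisector_dir A B C = sgn (B - A) + sgn (C - A)"

definition internal_bisector :: "complex \<Rightarrow> complex \<Rightarrow> complex \<Rightarrow> complex set" where
  "internal_bisector A B C = affine hull {A, A + bisector_dir A B C}"

definition external_bisector :: "complex \<Rightarrow> complex \<Rightarrow> complex \<Rightarrow> complex set" where
  "external_bisector A B C = {P. (P - A) \<bullet> bisector_dir A B C = 0}"

definition incenter :: "complex \<Rightarrow> complex \<Rightarrow> complex \<Rightarrow> complex" where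
  "incenter A B C =
     (THE P. P \<in> internal_bisector A B C \<and> P \<in> internal_bisector B C A \<and> P \<in> internal_bisector C A B)"

text \<open>The excenter opposite the first argument.\<close>

definition excenter :: "complex \<Rightarrow> complex \<Rightarrow> complex \<Rightarrow> complex" where
  "excenter A B C =
     (THE P. P \<in> internal_bisector A B C \<and> P \<in> external_bisector B C A \<and> P \<in> external_bisector C A B)"

definition bevan_point :: "complex \<Rightarrow> complex \<Rightarrow> complex \<Rightarrow> complex" where
  "bevan_point A B C = circumcenter (excenter A B C) (excenter B C A) (excenter C A B)"

definition reflect_dir :: "complex \<Rightarrow> complex \<Rightarrow> complex" where
  "reflect_dir u v = (2 * (v \<bullet> u) / (u \<bullet> u)) *\<^sub>R u - v"

text \<open>Direction of the reflection of the line \<open>AP\<close> in the bisector of the angle at \<open>A\<close>.\<close>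

definition isogonal_dir :: "complex \<Rightarrow> complex \<Rightarrow> complex \<Rightarrow> complex \<Rightarrow> complex" where
  "isogonal_dir A B C P = reflect_dir (bisector_dir A B C) (P - A)"

definition isogonal_line :: "complex \<Rightarrow> complex \<Rightarrow> complex \<Rightarrow> complex \<Rightarrow> complex set" where
  "isogonal_line A B C P = affine hull {A, A + isogonal_dir A B C P}"

definition is_isogonal_conjugate :: "complex \<Rightarrow> complex \<Rightarrow> complex \<Rightarrow> complex \<Rightarrow> complex \<Rightarrow> bool" where
  "is_isogonal_conjugate A B C P Q \<longleftrightarrow>
     P \<notin> {A, B, C} \<and>
     Q \<in> isogonal_line A B C P \<and> Q \<in> isogonal_line B C A P \<and> Q \<in> isogonal_line C A B P"

text \<open>If \<open>P\<close> lies on the circumcircle, the three reflected lines are parallel and the isogonal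
  conjugate of \<open>P\<close> is the point at infinity in their common direction \<open>d\<close>.\<close>

definition is_isogonal_conjugate_at_infinity ::
    "complex \<Rightarrow> complex \<Rightarrow> complex \<Rightarrow> complex \<Rightarrow> complex \<Rightarrow> bool" where
  "is_isogonal_conjugate_at_infinity A B C P d \<longleftrightarrow>
     P \<notin> {A, B, C} \<and> d \<noteq> 0 \<and>
     collinear {0, d, isogonal_dir A B C P} \<and>
     collinear {0, d, isogonal_dir B C A P} \<and>
     collinear {0, d, isogonal_dir C A B P}"

text \<open>\<open>P\<close>, its isogonal conjugate (possibly at infinity) and \<open>X\<close> are collinear.\<close>

definition collinear_with_isogonal_conjugate ::
    "complex \<Rightarrow> complex \<Rightarrow> complex \<Rightarrow> complex \<Rightarrow> complex \<Rightarrow> bool" where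
  "collinear_with_isogonal_conjugate A B C P X \<longleftrightarrow>
     (\<exists>Q. is_isogonal_conjugate A B C P Q \<and> collinear {P, Q, X}) \<or>
     (\<exists>d. is_isogonal_conjugate_at_infinity A B C P d \<and> collinear {P, P + d, X})"

definition cubic_curve :: "complex set \<Rightarrow> bool" where
  "cubic_curve K \<longleftrightarrow>
     (\<exists>c :: nat \<Rightarrow> nat \<Rightarrow> real. (\<exists>i\<le>3. c i (3 - i) \<noteq> 0) \<and>
        K = {P. (\<Sum>i\<le>3. \<Sum>j\<le>3 - i. c i j * Re P ^ i * Im P ^ j) = 0})"

text \<open>The nine listed points determine the cubic only for scalene triangles (for an isosceles
  triangle five of them lie on the axis of symmetry), so the locus property is part of the
  definition. The isogonal conjugate of a vertex is not defined, hence the locus property is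
  required of the other points only.\<close>

definition is_darboux_cubic :: "complex set \<Rightarrow> complex \<Rightarrow> complex \<Rightarrow> complex \<Rightarrow> bool" where
  "is_darboux_cubic K A B C \<longleftrightarrow>
     cubic_curve K \<and>
     {A, B, C} \<subseteq> K \<and>
     {excenter A B C, excenter B C A, excenter C A B} \<subseteq> K \<and>
     incenter A B C \<in> K \<and> circumcenter A B C \<in> K \<and> bevan_point A B C \<in> K \<and>
     (\<forall>P. P \<notin> {A, B, C} \<longrightarrow>
        (P \<in> K \<longleftrightarrow> collinear_with_isogonal_conjugate A B C P (de_longchamps_point A B C)))"

definition darboux_cubic :: "complex \<Rightarrow> complex \<Rightarrow> complex \<Rightarrow> complex set" where
  "darboux_cubic A B C = (THE K. is_darboux_cubic K A B C)"

text \<open>The vertex, on the altitude from the first argument, of the Euler triangle.\<close>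

definition euler_vertex :: "complex \<Rightarrow> complex \<Rightarrow> complex \<Rightarrow> complex" where
  "euler_vertex A B C = midpoint A (orthocenter A B C)"

end

theory Submission
  imports Defs
begin

text \<open>In complex coordinates in which the circumcircle is the unit circle, points \<open>p\<close> and \<open>q\<close> are
  isogonal conjugates with respect to \<open>a b c\<close> iff \<open>p + q + a b c p' q' = s\<close>, where \<open>s = a + b + c\<close> and
  primes denote complex conjugation. Solving for \<open>q\<close>, the collinearity of \<open>p\<close>, \<open>q\<close> and the de Longchamps
  point \<open>-s\<close> becomes a real cubic equation that is odd in \<open>p\<close> (the circumcenter is a centre of symmetry)
  and holds at the vertices, at all points with \<open>p = q\<close> (incenter and excenters) and at \<open>-s\<close>.
  With respect to its Euler triangle, whose circumcenter is the nine-point center of \<open>ABC\<close> and which is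
  the image of \<open>ABC\<close> under the homothety of ratio one half at the orthocenter, the points in question
  are its circumcenter, \<open>-s\<close> (circumcenter of \<open>ABC\<close>), \<open>s\<close> (orthocenter), its incenter, its vertices
  and their reflections in its circumcenter (midpoints of the sides).\<close>

section \<open>Incidence in the complex plane, circumcenter and orthocenter\<close>

lemma Re_of_real_mult: "Re (of_real x * z) = x * Re z"
  and Im_of_real_mult: "Im (of_real x * z) = x * Im z"
  by simp_all

lemma Im_mult_cnj_eq_0_iff:
  assumes "d \<noteq> 0"
  shows "Im (z * cnj d) = 0 \<longleftrightarrow> (\<exists>t. z = t *\<^sub>R d)"
proof
  assume *: "Im (z * cnj d) = 0"
  have "Im (z / d) = 0"
    using * by (simp add: Im_divide algebra_simps)
  then have "z / d = of_real (Re (z / d))"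
    by (simp add: complex_eq_iff)
  then have "z = Re (z / d) *\<^sub>R d"
    using assms by (simp add: scaleR_conv_of_real field_simps)
  then show "\<exists>t. z = t *\<^sub>R d" ..
qed (auto simp: algebra_simps)

lemma collinear_0_complex_iff: "collinear {0, x, y} \<longleftrightarrow> Im (x * cnj y) = 0" for x y :: complex
proof (cases "x = 0")
  case False
  have "Im (x * cnj y) = 0 \<longleftrightarrow> Im (y * cnj x) = 0"
    by (auto simp: algebra_simps)
  then show ?thesis
    using False Im_mult_cnj_eq_0_iff[of x y] by (auto simp: collinear_lemma)
qed simp

lemma collinear_complex_iff:
  "collinear {P, Q, X} \<longleftrightarrow> Im ((Q - P) * cnj (X - P)) = 0" for P Q X :: complex
proof -
  have "collinear {P, Q, X} \<longleftrightarrow> collinear {Q, P, X}"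
    by (simp add: insert_commute)
  also have "\<dots> \<longleftrightarrow> collinear {0, Q - P, X - P}"
    using collinear_3[of Q P X] by simp
  finally show ?thesis
    by (simp add: collinear_0_complex_iff)
qed

lemma noncollinear_distinct:
  fixes A B C :: complex
  assumes "\<not> collinear {A, B, C}"
  shows "A \<noteq> B" "B \<noteq> C" "C \<noteq> A"
  using assms by (auto simp: collinear_complex_iff algebra_simps)

lemma mem_affine_hull_dir_iff:
  "d \<noteq> 0 \<Longrightarrow> P \<in> affine hull {A, A + d} \<longleftrightarrow> Im ((P - A) * cnj d) = 0" for A d P :: complex
  unfolding Im_mult_cnj_eq_0_iff affine_hull_2_alt by (auto simp: algebra_simps)

text \<open>Two points equidistant from the vertices differ by a vector orthogonal to two
  independent sides, which must be zero. This turns the definite description into a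
  computation.\<close>

lemma circumcenter_eqI:
  assumes "\<not> collinear {A, B, C}" and "dist P A = dist P B" "dist P B = dist P C"
  shows "circumcenter A B C = P"
  unfolding circumcenter_def
proof (rule the_equality)
  fix Q assume Q: "dist Q A = dist Q B \<and> dist Q B = dist Q C"
  have perp: "((Q - P) \<bullet> (Y - X) = 0)" if "dist P X = dist P Y" "dist Q X = dist Q Y" for X Y
  proof -
    have "(dist P X)\<^sup>2 = (dist P Y)\<^sup>2" "(dist Q X)\<^sup>2 = (dist Q Y)\<^sup>2"
      using that by simp_all
    then show ?thesis
      unfolding dist_norm cmod_power2 inner_complex_def by (simp add: algebra_simps power2_eq_square)
  qed
  have "(Q - P) \<bullet> (B - A) = 0" "(Q - P) \<bullet> (C - A) = 0"
    using assms Q by (auto intro: perp)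
  then have "Re (Q - P) * Im ((B - A) * cnj (C - A)) = 0" "Im (Q - P) * Im ((B - A) * cnj (C - A)) = 0"
    unfolding inner_complex_def by simp_all algebra+
  then show "Q = P"
    using assms(1) by (simp add: collinear_complex_iff complex_eq_iff)
qed (use assms in auto)

lemma orthocenter_eqI:
  assumes "\<not> collinear {A, B, C}"
    and "(P - A) \<bullet> (B - C) = 0" "(P - B) \<bullet> (C - A) = 0" "(P - C) \<bullet> (A - B) = 0"
  shows "orthocenter A B C = P"
  unfolding orthocenter_def
proof (rule the_equality)
  fix Q assume Q: "(Q - A) \<bullet> (B - C) = 0 \<and> (Q - B) \<bullet> (C - A) = 0 \<and> (Q - C) \<bullet> (A - B) = 0"
  have "(Q - P) \<bullet> (C - A) = 0" "(Q - P) \<bullet> (B - A) = 0"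
    using Q assms by (auto simp: algebra_simps)
  then have "Re (Q - P) * Im ((B - A) * cnj (C - A)) = 0" "Im (Q - P) * Im ((B - A) * cnj (C - A)) = 0"
    unfolding inner_complex_def by simp_all algebra+
  then show "Q = P"
    using assms(1) by (simp add: collinear_complex_iff complex_eq_iff)
qed (use assms in auto)

lemma circumcenter_exists:
  fixes A B C :: complex
  assumes "\<not> collinear {A, B, C}"
  obtains P where "dist P A = dist P B" "dist P B = dist P C"
proof -
  define x y where "x = B - A" and "y = C - A"
  define D where "D = Im (x * cnj y)"
  have D: "D \<noteq> 0"
    using assms by (simp add: D_def x_def y_def collinear_complex_iff)
  \<comment> \<open>Cramer's rule for the linear system
    \<open>2 * (p \<bullet> x) = (cmod x)\<^sup>2\<close>,
    \<open>2 * (p \<bullet> y) = (cmod y)\<^sup>2\<close>, whose determinant is \<open>D\<close> up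
    to a constant factor; \<open>p\<close> is the circumcenter relative to \<open>A\<close>.\<close>
  define p where "p = Complex (((cmod y)\<^sup>2 * Im x - (cmod x)\<^sup>2 * Im y) / (2 * D))
    (((cmod x)\<^sup>2 * Re y - (cmod y)\<^sup>2 * Re x) / (2 * D))"
  have 1: "2 * (p \<bullet> x) = (cmod x)\<^sup>2" "2 * (p \<bullet> y) = (cmod y)\<^sup>2"
    using D by (simp_all add: p_def inner_complex_def field_simps) (simp_all add: D_def algebra_simps)
  have eq: "cmod p = cmod (p - z)" if "2 * (p \<bullet> z) = (cmod z)\<^sup>2" for z
  proof -
    have "(cmod p)\<^sup>2 = (cmod (p - z))\<^sup>2"
      using that unfolding cmod_power2 inner_complex_def by (simp add: algebra_simps power2_eq_square)
    then show ?thesis by simp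
  qed
  have "B = A + x" "C = A + y"
    by (simp_all add: x_def y_def)
  with eq[OF 1(1)] eq[OF 1(2)] have "dist (A + p) A = dist (A + p) B" "dist (A + p) B = dist (A + p) C"
    by (simp_all add: dist_norm)
  then show thesis ..
qed

section \<open>Angle bisectors and isogonal lines\<close>

lemma bisector_dir_nonzero:
  assumes "\<not> collinear {A, B, C}"
  shows "bisector_dir A B C \<noteq> 0"
proof
  assume "bisector_dir A B C = 0"
  then have "sgn (B - A) = - sgn (C - A)"
    by (simp add: bisector_dir_def eq_neg_iff_add_eq_0)
  then have "of_real (cmod (B - A)) * sgn (B - A) * cnj (of_real (cmod (C - A)) * sgn (C - A)) =
    - (of_real (cmod (B - A) * cmod (C - A)) * (sgn (C - A) * cnj (sgn (C - A))))"
    by simp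
  then have "Im (of_real (cmod (B - A)) * sgn (B - A) * cnj (of_real (cmod (C - A)) * sgn (C - A))) = 0"
    by (simp add: complex_mult_cnj)
  moreover have "of_real (cmod z) * sgn z = z" for z
    by (simp add: sgn_eq)
  ultimately show False
    using assms by (simp add: collinear_complex_iff)
qed

text \<open>Unit numbers \<open>e\<close>, \<open>f\<close> satisfy
  \<open>(e + f)\<^sup>2 = (cmod (e + f))\<^sup>2 * e * f\<close>. Squaring the bisector direction
  thus removes the square roots hidden in \<open>sgn\<close>, up to real factors.\<close>

lemma bisector_dir_square:
  "(bisector_dir A B C)\<^sup>2 * of_real (cmod (B - A) * cmod (C - A)) =
     of_real ((cmod (bisector_dir A B C))\<^sup>2) * ((B - A) * (C - A))"
proof (cases "B = A \<or> C = A")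
  case False
  define e f where "e = sgn (B - A)" and "f = sgn (C - A)"
  have ef: "B - A = of_real (cmod (B - A)) * e" "C - A = of_real (cmod (C - A)) * f"
    by (simp_all add: e_def f_def sgn_eq)
  have 1: "e * cnj e = 1" "f * cnj f = 1"
    using False by (simp_all add: e_def f_def complex_norm_square[symmetric] norm_sgn)
  have "(e + f)\<^sup>2 = (e + f) * cnj (e + f) * (e * f)"
    using 1 unfolding complex_cnj_add by algebra
  also have "\<dots> = of_real ((cmod (e + f))\<^sup>2) * (e * f)"
    by (simp only: complex_norm_square)
  finally have "(e + f)\<^sup>2 = of_real ((cmod (e + f))\<^sup>2) * (e * f)" .
  then show ?thesis
    unfolding bisector_dir_def e_def[symmetric] f_def[symmetric]
    by (subst ef(1), subst ef(2)) simp
qed auto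

lemma Im_mult_cnj_bisector:
  assumes "\<not> collinear {A, B, C}"
  shows "Im (z * cnj ((bisector_dir A B C)\<^sup>2)) = 0 \<longleftrightarrow> Im (z * cnj ((B - A) * (C - A))) = 0"
proof -
  let ?u = "bisector_dir A B C" and ?D = "(B - A) * (C - A)"
  have ne: "cmod (B - A) * cmod (C - A) \<noteq> 0" "(cmod ?u)\<^sup>2 \<noteq> 0"
    using noncollinear_distinct[OF assms] bisector_dir_nonzero[OF assms] by auto
  have "z * cnj (?u\<^sup>2) * of_real (cmod (B - A) * cmod (C - A)) = z * cnj (?u\<^sup>2 * of_real (cmod (B - A) * cmod (C - A)))"
    by simp
  also have "\<dots> = z * cnj ?D * of_real ((cmod ?u)\<^sup>2)"
    unfolding bisector_dir_square by simp
  finally have "Im (z * cnj (?u\<^sup>2)) * (cmod (B - A) * cmod (C - A)) = Im (z * cnj ?D) * (cmod ?u)\<^sup>2"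
    by (metis Im_of_real_mult mult.commute)
  with ne show ?thesis by (metis mult_eq_0_iff)
qed

text \<open>Reflecting \<open>v\<close> in the direction \<open>u\<close> gives
  \<open>u\<^sup>2 * cnj v / (cmod u)\<^sup>2\<close>. So \<open>(Q - A) * (P - A)\<close> has to be
  a real multiple of \<open>u\<^sup>2\<close>, equivalently of \<open>(B - A) * (C - A)\<close>, a
  condition that is polynomial and symmetric in \<open>P\<close> and \<open>Q\<close>.\<close>

lemma mem_isogonal_line_iff:
  assumes "\<not> collinear {A, B, C}" and "P \<noteq> A"
  shows "isogonal_dir A B C P \<noteq> 0"
    and "Im (d * cnj (isogonal_dir A B C P)) = 0 \<longleftrightarrow> Im (d * (P - A) * cnj ((B - A) * (C - A))) = 0"
    and "Q \<in> isogonal_line A B C P \<longleftrightarrow> Im ((Q - A) * (P - A) * cnj ((B - A) * (C - A))) = 0"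
proof -
  let ?u = "bisector_dir A B C"
  have u: "?u \<noteq> 0"
    by (rule bisector_dir_nonzero[OF assms(1)])
  have "of_real (v \<bullet> ?u) * 2 = v * cnj ?u + cnj v * ?u" for v
    by (simp add: inner_complex_def complex_eq_iff)
  then have refl: "reflect_dir ?u v * of_real ((cmod ?u)\<^sup>2) = ?u\<^sup>2 * cnj v" for v
    unfolding reflect_dir_def scaleR_conv_of_real dot_square_norm of_real_divide of_real_mult
    unfolding complex_norm_square using u by (simp add: field_simps power2_eq_square)
  have eq: "isogonal_dir A B C P * of_real ((cmod ?u)\<^sup>2) = ?u\<^sup>2 * cnj (P - A)"
    using refl by (simp only: isogonal_dir_def)
  have u2: "(cmod ?u)\<^sup>2 \<noteq> 0" using u by simp
  from eq assms(2) u show nz: "isogonal_dir A B C P \<noteq> 0"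
    by auto
  have iff: "Im (d * cnj (isogonal_dir A B C P)) = 0 \<longleftrightarrow> Im (d * (P - A) * cnj ((B - A) * (C - A))) = 0" for d
  proof -
    have "d * cnj (isogonal_dir A B C P) * of_real ((cmod ?u)\<^sup>2) = d * (P - A) * cnj (?u\<^sup>2)"
      using arg_cong[OF eq, of cnj] by simp
    then have "Im (d * cnj (isogonal_dir A B C P)) * (cmod ?u)\<^sup>2 = Im (d * (P - A) * cnj (?u\<^sup>2))"
      by (metis Im_of_real_mult mult.commute)
    with u2 show ?thesis
      using Im_mult_cnj_bisector[OF assms(1)] by (metis mult_eq_0_iff)
  qed
  show "Im (d * cnj (isogonal_dir A B C P)) = 0 \<longleftrightarrow> Im (d * (P - A) * cnj ((B - A) * (C - A))) = 0"
    by (rule iff)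
  show "Q \<in> isogonal_line A B C P \<longleftrightarrow> Im ((Q - A) * (P - A) * cnj ((B - A) * (C - A))) = 0"
    unfolding isogonal_line_def mem_affine_hull_dir_iff[OF nz] iff ..
qed

lemma mem_internal_bisector_iff:
  assumes "\<not> collinear {A, B, C}"
  shows "P \<in> internal_bisector A B C \<longleftrightarrow> Im ((P - A) * cnj (bisector_dir A B C)) = 0"
  unfolding internal_bisector_def
  by (rule mem_affine_hull_dir_iff[OF bisector_dir_nonzero[OF assms]])

lemma mem_external_bisector_iff:
  "P \<in> external_bisector A B C \<longleftrightarrow> Re ((P - A) * cnj (bisector_dir A B C)) = 0"
  by (simp add: external_bisector_def inner_complex_def)

lemma bisectors_meet_at_vertex:
  assumes "\<not> collinear {A, B, C}" "P \<in> internal_bisector A B C" "P \<in> external_bisector A B C"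
  shows "P = A"
proof -
  have "(P - A) * cnj (bisector_dir A B C) = 0"
    using assms by (simp add: mem_internal_bisector_iff mem_external_bisector_iff complex_eq_iff)
  with bisector_dir_nonzero[OF assms(1)] show ?thesis by simp
qed

text \<open>The square of \<open>z * cnj u\<close> is real iff \<open>z * cnj u\<close> is real or
  purely imaginary, so one equation describes both bisectors at a vertex.\<close>

lemma Im_square_cnj_bisector:
  assumes "\<not> collinear {A, B, C}"
  shows "Im (z\<^sup>2 * cnj ((B - A) * (C - A))) = 0 \<longleftrightarrow>
    Im (z * cnj (bisector_dir A B C)) = 0 \<or> Re (z * cnj (bisector_dir A B C)) = 0"
proof -
  have "Im (z\<^sup>2 * cnj ((bisector_dir A B C)\<^sup>2)) = Im ((z * cnj (bisector_dir A B C))\<^sup>2)"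
    by (simp only: power_mult_distrib complex_cnj_power)
  then show ?thesis
    unfolding Im_mult_cnj_bisector[OF assms, symmetric] by (auto simp only: Im_power2 mult_eq_0_iff)
qed

text \<open>A common direction of bisectors at \<open>A\<close> and at \<open>B\<close> would make
  \<open>(B - A) * (C - A)\<close> and \<open>(C - B) * (A - B)\<close> real multiples of each
  other. Cancelling the shared side leaves \<open>C - A\<close> parallel to
  \<open>C - B\<close>.\<close>

lemma bisectors_not_parallel:
  assumes "\<not> collinear {A, B, C}"
    and A: "Im (z\<^sup>2 * cnj ((B - A) * (C - A))) = 0"
    and B: "Im (z\<^sup>2 * cnj ((C - B) * (A - B))) = 0"
  shows "z = 0"
proof (rule ccontr)
  assume z: "z \<noteq> 0"
  define D E where "D = (B - A) * (C - A)" and "E = (C - B) * (A - B)"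
  have "Im (v * cnj w) = 0" if "Im v = 0" "Im w = 0" for v w
    using that by simp
  with A B have "Im ((z\<^sup>2 * cnj D) * cnj (z\<^sup>2 * cnj E)) = 0"
    unfolding D_def E_def by blast
  moreover have "(z\<^sup>2 * cnj D) * cnj (z\<^sup>2 * cnj E) = (z * cnj z)\<^sup>2 * (cnj D * E)"
    by (simp add: power2_eq_square)
  also have "\<dots> = of_real (((cmod z)\<^sup>2)\<^sup>2) * (cnj D * E)"
    unfolding complex_norm_square[symmetric] by simp
  ultimately have "Im (cnj D * E) = 0"
    using z by (simp only: Im_of_real_mult) simp
  also have "cnj D * E = - (((B - A) * cnj (B - A)) * (cnj (C - A) * (C - B)))"
    by (simp add: D_def E_def algebra_simps)
  also have "\<dots> = of_real (- (cmod (B - A))\<^sup>2) * (cnj (C - A) * (C - B))"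
    unfolding complex_norm_square[symmetric] by simp
  finally have "B = A \<or> Im (cnj (C - A) * (C - B)) = 0"
    by simp
  moreover have "Im (cnj (C - A) * (C - B)) = - Im ((B - A) * cnj (C - A))"
    by (simp add: algebra_simps)
  ultimately show False
    using assms(1) by (auto simp: collinear_complex_iff)
qed

lemma bisector_intersection_unique:
  assumes nc: "\<not> collinear {A, B, C}"
    and A: "{P, Q} \<subseteq> internal_bisector A B C"
    and B: "{P, Q} \<subseteq> internal_bisector B C A \<or> {P, Q} \<subseteq> external_bisector B C A"
  shows "P = Q"
proof -
  have nc': "\<not> collinear {B, C, A}"
    using nc by (simp add: insert_commute)
  have diff: "(P - Q) * w = (P - X) * w - (Q - X) * w" for w X
    by (simp add: algebra_simps)
  have "Im ((P - Q) * cnj (bisector_dir A B C)) = 0"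
    using A unfolding diff[of _ A] by (simp add: mem_internal_bisector_iff[OF nc])
  moreover have "Im ((P - Q) * cnj (bisector_dir B C A)) = 0 \<or> Re ((P - Q) * cnj (bisector_dir B C A)) = 0"
    using B unfolding diff[of _ B]
    by (auto simp add: mem_internal_bisector_iff[OF nc'] mem_external_bisector_iff simp del: times_complex.sel)
  ultimately have "P - Q = 0"
    by (intro bisectors_not_parallel[OF nc])
      (simp_all only: Im_square_cnj_bisector[OF nc] Im_square_cnj_bisector[OF nc'] simp_thms)
  then show ?thesis by simp
qed

section \<open>Existence of the incenter and the excenters\<close>

lemma scaled_bisector_dir:
  "of_real (cmod x * cmod y) * (sgn x + sgn y) = of_real (cmod y) * x + of_real (cmod x) * (y :: complex)"
  "of_real (cmod x * cmod y) * (sgn x - sgn y) = of_real (cmod y) * x - of_real (cmod x) * (y :: complex)"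
  by (cases "x = 0"; cases "y = 0"; simp add: sgn_eq field_simps)+

lemma internal_bisectorI:
  assumes "\<not> collinear {A, B, C}" "S \<noteq> 0"
    and "of_real S * (P - A) = of_real (dist C A) * (B - A) + of_real (dist B A) * (C - A)"
  shows "P \<in> internal_bisector A B C"
proof -
  let ?u = "bisector_dir A B C"
  have "of_real S * (P - A) = of_real (cmod (B - A) * cmod (C - A)) * ?u"
    unfolding assms(3) bisector_dir_def scaled_bisector_dir by (simp add: dist_norm)
  then have "of_real S * ((P - A) * cnj ?u) = of_real (cmod (B - A) * cmod (C - A)) * (?u * cnj ?u)"
    by (metis mult.assoc)
  then have "Im (of_real S * ((P - A) * cnj ?u)) = 0"
    unfolding complex_norm_square[symmetric] by (simp flip: of_real_mult of_real_power)
  then show ?thesis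
    unfolding mem_internal_bisector_iff[OF assms(1)] Im_of_real_mult using assms(2) by simp
qed

text \<open>The right-hand side of the second premise is a multiple of the difference of the two
  unit side vectors, and this difference is orthogonal to their sum.\<close>

lemma external_bisectorI:
  assumes "S \<noteq> 0"
    and "of_real S * (P - A) = of_real (dist C A) * (B - A) - of_real (dist B A) * (C - A)"
    and "A \<noteq> B" "A \<noteq> C"
  shows "P \<in> external_bisector A B C"
proof -
  let ?u = "bisector_dir A B C"
  have "of_real S * (P - A) = of_real (cmod (B - A) * cmod (C - A)) * (sgn (B - A) - sgn (C - A))"
    unfolding assms(2) scaled_bisector_dir by (simp add: dist_norm)
  then have "of_real S * ((P - A) * cnj ?u) = of_real (cmod (B - A) * cmod (C - A)) * ((sgn (B - A) - sgn (C - A)) * cnj ?u)"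
    by (metis mult.assoc)
  moreover have "Re ((sgn (B - A) - sgn (C - A)) * cnj ?u) = (cmod (sgn (B - A)))\<^sup>2 - (cmod (sgn (C - A)))\<^sup>2"
    unfolding cmod_power2 bisector_dir_def by (simp add: algebra_simps power2_eq_square)
  moreover have "\<dots> = 0"
    using assms by (simp add: norm_sgn)
  ultimately have "Re (of_real S * ((P - A) * cnj ?u)) = 0"
    by (simp only: Re_of_real_mult mult_zero_right)
  then show ?thesis
    unfolding mem_external_bisector_iff Re_of_real_mult using assms(1) by simp
qed

lemma incenter_mem:
  assumes nc: "\<not> collinear {A, B, C}"
  shows "incenter A B C \<in> internal_bisector A B C" "incenter A B C \<in> internal_bisector B C A"
    "incenter A B C \<in> internal_bisector C A B"
proof -
  have nc': "\<not> collinear {B, C, A}" "\<not> collinear {C, A, B}"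
    using nc by (simp_all add: insert_commute)
  note ne = noncollinear_distinct[OF nc]
  define S where "S = dist B C + dist C A + dist A B"
  have S: "S \<noteq> 0"
    using ne unfolding S_def by (metis add_nonneg_eq_0_iff add_nonneg_nonneg dist_eq_0_iff zero_le_dist)
  \<comment> \<open>The incenter in barycentric coordinates, weighted by the lengths of the opposite
    sides.\<close>
  define P where "P = (of_real (dist B C) * A + of_real (dist C A) * B + of_real (dist A B) * C) / of_real S"
  have "of_real S * P = of_real (dist B C) * A + of_real (dist C A) * B + of_real (dist A B) * C"
    using S by (simp add: P_def)
  then have "P \<in> internal_bisector A B C \<and> P \<in> internal_bisector B C A \<and> P \<in> internal_bisector C A B"
    using S nc nc' by (auto intro!: internal_bisectorI[where S = S] simp: algebra_simps S_def dist_commute)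
  moreover have "P = Q" if "P \<in> internal_bisector A B C \<and> P \<in> internal_bisector B C A"
    "Q \<in> internal_bisector A B C \<and> Q \<in> internal_bisector B C A" for P Q
    using that by (intro bisector_intersection_unique[OF nc]) auto
  ultimately have "\<exists>!P. P \<in> internal_bisector A B C \<and> P \<in> internal_bisector B C A \<and> P \<in> internal_bisector C A B"
    by blast
  from theI'[OF this] show "incenter A B C \<in> internal_bisector A B C" "incenter A B C \<in> internal_bisector B C A"
    "incenter A B C \<in> internal_bisector C A B"
    by (auto simp: incenter_def)
qed

lemma excenter_mem:
  assumes nc: "\<not> collinear {A, B, C}"
  shows "excenter A B C \<in> internal_bisector A B C" "excenter A B C \<in> external_bisector B C A"
    "excenter A B C \<in> external_bisector C A B"
proof -
  have nc': "\<not> collinear {B, C, A}" "\<not> collinear {C, A, B}"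
    using nc by (simp_all add: insert_commute)
  note ne = noncollinear_distinct[OF nc]
  define S where "S = dist C A + dist A B - dist B C"
  \<comment> \<open>This is the strict triangle inequality: equality would put \<open>A\<close> on
    the segment from \<open>B\<close> to \<open>C\<close>.\<close>
  have S: "S \<noteq> 0"
  proof
    assume "S = 0"
    then have "between (B, C) A"
      by (simp add: S_def between dist_commute)
    then have "collinear {B, A, C}" by (rule between_imp_collinear)
    then show False using nc by (simp add: insert_commute)
  qed
  \<comment> \<open>At \<open>C\<close> the two sides enter \<open>external_bisectorI\<close> in the
    opposite order, so the equation for \<open>P\<close> fits with \<open>- S\<close> in place of
    \<open>S\<close>.\<close>
  then have S': "- S \<noteq> 0" by simp
  \<comment> \<open>The barycentric weights of the incenter with the sign of the first one
    reversed.\<close>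
  define P where "P = (- of_real (dist B C) * A + of_real (dist C A) * B + of_real (dist A B) * C) / of_real S"
  have P: "of_real S * P = - of_real (dist B C) * A + of_real (dist C A) * B + of_real (dist A B) * C"
    using S by (simp add: P_def)
  have "P \<in> internal_bisector A B C"
    by (rule internal_bisectorI[OF nc S]) (use P in \<open>simp add: algebra_simps S_def dist_commute\<close>)
  moreover have "P \<in> external_bisector B C A"
    by (rule external_bisectorI[OF S]) (use P ne in \<open>auto simp: algebra_simps S_def dist_commute\<close>)
  moreover have "P \<in> external_bisector C A B"
    by (rule external_bisectorI[OF S']) (use P ne in \<open>auto simp: algebra_simps S_def dist_commute\<close>)
  moreover have "P = Q" if "P \<in> internal_bisector A B C \<and> P \<in> external_bisector B C A"
    "Q \<in> internal_bisector A B C \<and> Q \<in> external_bisector B C A" for P Q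
    using that by (intro bisector_intersection_unique[OF nc]) auto
  ultimately have "\<exists>!P. P \<in> internal_bisector A B C \<and> P \<in> external_bisector B C A \<and> P \<in> external_bisector C A B"
    by blast
  from theI'[OF this] show "excenter A B C \<in> internal_bisector A B C" "excenter A B C \<in> external_bisector B C A"
    "excenter A B C \<in> external_bisector C A B"
    by (auto simp: excenter_def)
qed

section \<open>Isogonal lines of a triangle inscribed in the unit circle\<close>

text \<open>On the unit circle conjugation is inversion, so \<open>D = (b - a) * (c - a)\<close>
  satisfies \<open>a * (a * b * c) * cnj D = D\<close>; reality of \<open>z * cnj D\<close> then no
  longer involves \<open>D\<close>.\<close>

lemma unit_bisector_line_iff:
  assumes unit: "a * cnj a = 1" "b * cnj b = 1" "c * cnj c = 1" and ne: "a \<noteq> b" "a \<noteq> c"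
  shows "Im (z * cnj ((b - a) * (c - a))) = 0 \<longleftrightarrow> z = a * (a * b * c) * cnj z"
proof -
  define D where "D = (b - a) * (c - a)"
  have D: "D \<noteq> 0" using ne by (simp add: D_def)
  have cD: "a * (a * b * c) * cnj D = D"
    unfolding D_def complex_cnj_mult complex_cnj_diff using unit by algebra
  have "Im (z * cnj D) = 0 \<longleftrightarrow> z * cnj D = cnj z * D"
    by (auto simp: complex_eq_iff algebra_simps)
  also have "\<dots> \<longleftrightarrow> (z - a * (a * b * c) * cnj z) * cnj D = 0"
    by (subst (2) cD[symmetric]) (simp add: algebra_simps)
  finally show ?thesis
    using D by (simp add: D_def)
qed

text \<open>The same \<open>T\<close>, symmetric in \<open>a\<close>, \<open>b\<close>,
  \<open>c\<close>, serves all three vertices, so the three isogonal lines impose three conditions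
  on one number.\<close>

lemma isogonal_line_unit_iff:
  fixes a b c p q :: complex
  defines "T \<equiv> p + q + a * b * c * cnj p * cnj q - (a + b + c)"
  assumes unit: "a * cnj a = 1" "b * cnj b = 1" "c * cnj c = 1" and ne: "a \<noteq> b" "a \<noteq> c"
  shows "Im ((q - a) * (p - a) * cnj ((b - a) * (c - a))) = 0 \<longleftrightarrow> a * b * c * cnj T = a * T"
proof -
  have "(q - a) * (p - a) - a * (a * b * c) * cnj ((q - a) * (p - a)) = a * b * c * cnj T - a * T"
    unfolding T_def complex_cnj_mult complex_cnj_diff complex_cnj_add complex_cnj_cnj using unit by algebra
  then show ?thesis
    unfolding unit_bisector_line_iff[OF unit ne] by (metis right_minus_eq)
qed

text \<open>The version at infinity: \<open>T\<close> keeps only the terms that are linear in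
  \<open>q\<close>, with \<open>d\<close> in place of \<open>q\<close>.\<close>

lemma isogonal_dir_unit_iff:
  fixes a b c p d :: complex
  defines "T \<equiv> d + a * b * c * cnj p * cnj d"
  assumes unit: "a * cnj a = 1" "b * cnj b = 1" "c * cnj c = 1" and ne: "a \<noteq> b" "a \<noteq> c"
  shows "Im (d * (p - a) * cnj ((b - a) * (c - a))) = 0 \<longleftrightarrow> a * b * c * cnj T = a * T"
proof -
  have "d * (p - a) - a * (a * b * c) * cnj (d * (p - a)) = a * b * c * cnj T - a * T"
    unfolding T_def complex_cnj_mult complex_cnj_diff complex_cnj_add complex_cnj_cnj using unit by algebra
  then show ?thesis
    unfolding unit_bisector_line_iff[OF unit ne] by (metis right_minus_eq)
qed

text \<open>Relative to the center, conjugation is \<open>R\<close> times inversion, and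
  collinearity becomes the vanishing of \<open>R * ((b - a) * (c - a) * (c - b))\<close>.\<close>

lemma concyclic_not_collinear:
  fixes P A B C :: complex
  assumes eq: "dist P A = dist P B" "dist P B = dist P C" and ne: "A \<noteq> B" "B \<noteq> C" "C \<noteq> A"
  shows "\<not> collinear {A, B, C}"
proof
  assume "collinear {A, B, C}"
  then have "Im ((B - A) * cnj (C - A)) = 0"
    by (simp only: collinear_complex_iff)
  then have *: "(B - A) * cnj (C - A) = cnj (B - A) * (C - A)"
    by (auto simp: complex_eq_iff algebra_simps)
  define a b c where "a = A - P" and "b = B - P" and "c = C - P"
  define R :: complex where "R = of_real ((dist P A)\<^sup>2)"
  have R: "a * cnj a = R" "b * cnj b = R" "c * cnj c = R"
    unfolding a_def b_def c_def R_def complex_norm_square[symmetric] using eq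
    by (simp_all add: dist_norm norm_minus_commute)
  have "(b - a) * (cnj c - cnj a) = (cnj b - cnj a) * (c - a)"
    using * by (simp add: a_def b_def c_def)
  then have "R * ((b - a) * (c - a) * (c - b)) = 0"
    using R by algebra
  moreover have "R \<noteq> 0"
    using eq ne by (auto simp: R_def)
  ultimately show False
    using ne by (auto simp: a_def b_def c_def)
qed

section \<open>Uniqueness of the Darboux cubic; cubics under similarities\<close>

text \<open>The locus property decides membership away from the vertices, and the vertices are
  members by definition, so the curve is unique.\<close>

lemma darboux_cubic_eqI:
  assumes "is_darboux_cubic K A B C"
  shows "darboux_cubic A B C = K"
  unfolding darboux_cubic_def
proof (rule the_equality)
  fix L assume "is_darboux_cubic L A B C"
  with assms have "{A, B, C} \<subseteq> L" "{A, B, C} \<subseteq> K" "\<And>P. P \<notin> {A, B, C} \<Longrightarrow> P \<in> L \<longleftrightarrow> P \<in> K"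
    by (simp_all add: is_darboux_cubic_def)
  then show "L = K" by blast
qed (rule assms)

lemma cubic_curve_affine_image:
  fixes m :: complex and r :: real and f :: "complex \<Rightarrow> real"
  assumes f: "\<And>p. f p = c30 * Re p ^ 3 + c21 * (Re p)\<^sup>2 * Im p + c12 * Re p * (Im p)\<^sup>2 + c03 * Im p ^ 3
      + c10 * Re p + c01 * Im p"
    and lead: "c30 \<noteq> 0 \<or> c21 \<noteq> 0 \<or> c12 \<noteq> 0 \<or> c03 \<noteq> 0"
    and r: "r \<noteq> 0"
  shows "cubic_curve ((\<lambda>p. m + of_real r * p) ` {p. f p = 0})"
proof -
  define x y where "x = Re m" and "y = Im m"
  \<comment> \<open>These are the lower coefficients of \<open>r ^ 3 * f ((P - m) / r)\<close> as a
    polynomial in the coordinates of \<open>P\<close>. The factor \<open>r ^ 3\<close> clears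
    denominators and leaves the cubic coefficients of \<open>f\<close> unchanged.\<close>
  define d00 where "d00 = - (c30 * x ^ 3 + c21 * x\<^sup>2 * y + c12 * x * y\<^sup>2 + c03 * y ^ 3) - r\<^sup>2 * c10 * x - r\<^sup>2 * c01 * y"
  define d01 where "d01 = c21 * x\<^sup>2 + 2 * c12 * x * y + 3 * c03 * y\<^sup>2 + r\<^sup>2 * c01"
  define d10 where "d10 = 3 * c30 * x\<^sup>2 + 2 * c21 * x * y + c12 * y\<^sup>2 + r\<^sup>2 * c10"
  define d02 where "d02 = - c12 * x - 3 * c03 * y"
  define d11 where "d11 = - 2 * c21 * x - 2 * c12 * y"
  define d20 where "d20 = - 3 * c30 * x - c21 * y"
  \<comment> \<open>Row \<open>i\<close> has just the \<open>4 - i\<close> entries that the double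
    sum over \<open>j \<le> 3 - i\<close> reads.\<close>
  define co where "co i j = [[d00, d01, d02, c03], [d10, d11, c12], [d20, c21], [c30]] ! i ! j" for i j :: nat
  have "co 3 (3 - 3) = c30" "co 2 (3 - 2) = c21" "co 1 (3 - 1) = c12" "co 0 (3 - 0) = c03"
    by (simp_all add: co_def numeral_eq_Suc)
  moreover have "(3::nat) \<le> 3" "(2::nat) \<le> 3" "(1::nat) \<le> 3" "(0::nat) \<le> 3"
    by simp_all
  ultimately have top: "\<exists>i\<le>3. co i (3 - i) \<noteq> 0"
    using lead by metis
  have sum: "(\<Sum>i\<le>3. \<Sum>j\<le>3 - i. co i j * X ^ i * Y ^ j) = d00 + d01 * Y + d02 * Y\<^sup>2 + c03 * Y ^ 3
      + d10 * X + d11 * X * Y + c12 * X * Y\<^sup>2 + d20 * X\<^sup>2 + c21 * X\<^sup>2 * Y + c30 * X ^ 3" for X Y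
    by (simp add: co_def numeral_eq_Suc)
  have poly: "(\<Sum>i\<le>3. \<Sum>j\<le>3 - i. co i j * Re (m + of_real r * p) ^ i * Im (m + of_real r * p) ^ j) = r ^ 3 * f p" for p
  proof -
    have "Re (m + of_real r * p) = x + r * Re p" "Im (m + of_real r * p) = y + r * Im p"
      by (simp_all add: x_def y_def)
    then show ?thesis
      unfolding sum f d00_def d01_def d10_def d02_def d11_def d20_def by algebra
  qed
  have "(\<lambda>p. m + of_real r * p) ` {p. f p = 0} = {P. (\<Sum>i\<le>3. \<Sum>j\<le>3 - i. co i j * Re P ^ i * Im P ^ j) = 0}"
  proof (intro set_eqI)
    fix P
    define p where "p = (P - m) / of_real r"
    have P: "P = m + of_real r * p"
      using r by (simp add: p_def)
    have "P \<in> (\<lambda>p. m + of_real r * p) ` {p. f p = 0} \<longleftrightarrow> f p = 0"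
      using r by (auto simp: P)
    also have "\<dots> \<longleftrightarrow> (\<Sum>i\<le>3. \<Sum>j\<le>3 - i. co i j * Re P ^ i * Im P ^ j) = 0"
      unfolding P poly using r by simp
    finally show "P \<in> (\<lambda>p. m + of_real r * p) ` {p. f p = 0} \<longleftrightarrow>
        P \<in> {P. (\<Sum>i\<le>3. \<Sum>j\<le>3 - i. co i j * Re P ^ i * Im P ^ j) = 0}"
      by simp
  qed
  with top show ?thesis
    unfolding cubic_curve_def by blast
qed

text \<open>The triangle \<open>m + r * a\<close>, \<open>m + r * b\<close>, \<open>m + r * c\<close> with \<open>a\<close>, \<open>b\<close>, \<open>c\<close> on the unit circle. A
  triangle and its Euler triangle share the same \<open>a\<close>, \<open>b\<close>, \<open>c\<close>, hence the same \<open>darboux_form\<close>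
  below.\<close>

locale circle_triangle =
  fixes m :: complex and r :: real and a b c :: complex
  assumes radius_pos: "r > 0"
    and norm_one: "cmod a = 1" "cmod b = 1" "cmod c = 1"
    and distinct: "a \<noteq> b" "b \<noteq> c" "c \<noteq> a"
begin

definition pt :: "complex \<Rightarrow> complex" where "pt p = m + of_real r * p"

definition s :: complex where "s = a + b + c"

definition k :: complex where "k = a * b * c"

definition conjugates :: "complex \<Rightarrow> complex \<Rightarrow> bool" where
  "conjugates p q \<longleftrightarrow> p + q + k * cnj p * cnj q = s"

text \<open>Eliminating \<open>cnj q\<close> between \<open>conjugates p q\<close> and its complex conjugate gives
  \<open>q * (1 - p * cnj p) = conj_num p\<close>; on the circumcircle \<open>conj_num p\<close> is the direction of the
  isogonal conjugate at infinity.\<close>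

definition conj_num :: "complex \<Rightarrow> complex" where
  "conj_num p = s - p - k * cnj p * cnj (s - p)"

text \<open>For \<open>p\<close> off the unit circle with conjugate \<open>q\<close>, this is the
  collinearity form of \<open>p\<close>, \<open>q\<close>, \<open>- s\<close> multiplied by the real
  number \<open>1 - p * cnj p\<close>. Avoiding the division by that number extends the form to the
  circumcircle.\<close>

definition darboux_form :: "complex \<Rightarrow> real" where
  "darboux_form p = Im ((conj_num p - p * (1 - p * cnj p)) * cnj (- s - p))"

definition darboux_set :: "complex set" where
  "darboux_set = pt ` {p. darboux_form p = 0}"

section \<open>Coordinates adapted to the circumcircle\<close>

lemma unit: "a * cnj a = 1" "b * cnj b = 1" "c * cnj c = 1"
  using norm_one by (simp_all add: complex_norm_square[symmetric])

lemma k_unit: "k * cnj k = 1"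
  unfolding k_def complex_cnj_mult using unit by algebra

lemma pt_eq_iff [simp]: "pt p = pt q \<longleftrightarrow> p = q"
  using radius_pos by (simp add: pt_def)

lemma pt_cases: obtains p where "P = pt p"
proof
  show "P = pt ((P - m) / of_real r)"
    using radius_pos by (simp add: pt_def)
qed

lemma pt_diff: "pt p - pt q = of_real r * (p - q)"
  by (simp add: pt_def algebra_simps)

lemma dist_pt: "dist (pt p) (pt q) = r * dist p q"
  using radius_pos by (simp add: dist_norm pt_diff norm_mult)

lemma pt_in_darboux_set_iff: "pt p \<in> darboux_set \<longleftrightarrow> darboux_form p = 0"
  by (auto simp: darboux_set_def)

lemma not_collinear: "\<not> collinear {pt a, pt b, pt c}"
  using norm_one distinct by (intro concyclic_not_collinear[of "pt 0"]) (simp_all add: dist_pt)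

lemma not_collinear_rotate: "\<not> collinear {pt b, pt c, pt a}" "\<not> collinear {pt c, pt a, pt b}"
  using not_collinear by (simp_all add: insert_commute)

lemma collinear_pt_iff: "collinear {pt p, pt q, pt x} \<longleftrightarrow> Im ((q - p) * cnj (x - p)) = 0"
proof -
  have "(pt q - pt p) * cnj (pt x - pt p) = of_real (r * r) * ((q - p) * cnj (x - p))"
    by (simp add: pt_diff)
  then show ?thesis
    using radius_pos by (simp only: collinear_complex_iff Im_of_real_mult) simp
qed

lemma collinear_pt_dir_iff: "collinear {pt p, pt p + d, pt x} \<longleftrightarrow> Im (d * cnj (x - p)) = 0"
proof -
  have "(pt p + d - pt p) * cnj (pt x - pt p) = of_real r * (d * cnj (x - p))"
    by (simp add: pt_diff)
  then show ?thesis
    using radius_pos by (simp only: collinear_complex_iff Im_of_real_mult) simp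
qed

lemma Im_scaled_line:
  "Im ((pt q - pt x) * (pt p - pt x) * cnj ((pt y - pt x) * (pt z - pt x))) = 0 \<longleftrightarrow>
   Im ((q - x) * (p - x) * cnj ((y - x) * (z - x))) = 0"
proof -
  have "(pt q - pt x) * (pt p - pt x) * cnj ((pt y - pt x) * (pt z - pt x)) =
    of_real (r ^ 4) * ((q - x) * (p - x) * cnj ((y - x) * (z - x)))"
    by (simp add: pt_diff power4_eq_xxxx)
  then show ?thesis
    using radius_pos by (simp only: Im_of_real_mult) simp
qed

lemma Im_scaled_dir:
  "Im (d * (pt p - pt x) * cnj ((pt y - pt x) * (pt z - pt x))) = 0 \<longleftrightarrow>
   Im (d * (p - x) * cnj ((y - x) * (z - x))) = 0"
proof -
  have "d * (pt p - pt x) * cnj ((pt y - pt x) * (pt z - pt x)) =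
    of_real (r ^ 3) * (d * (p - x) * cnj ((y - x) * (z - x)))"
    by (simp add: pt_diff power3_eq_cube)
  then show ?thesis
    using radius_pos by (simp only: Im_of_real_mult) simp
qed

section \<open>Isogonal conjugation in these coordinates\<close>

lemma line_iff:
  fixes p q
  defines "T \<equiv> p + q + k * cnj p * cnj q - s"
  shows "Im ((q - a) * (p - a) * cnj ((b - a) * (c - a))) = 0 \<longleftrightarrow> k * cnj T = a * T"
    and "Im ((q - b) * (p - b) * cnj ((c - b) * (a - b))) = 0 \<longleftrightarrow> k * cnj T = b * T"
    and "Im ((q - c) * (p - c) * cnj ((a - c) * (b - c))) = 0 \<longleftrightarrow> k * cnj T = c * T"
proof -
  have k: "k = b * c * a" "k = c * a * b" and s: "s = b + c + a" "s = c + a + b"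
    by (simp_all add: k_def s_def)
  show "Im ((q - a) * (p - a) * cnj ((b - a) * (c - a))) = 0 \<longleftrightarrow> k * cnj T = a * T"
    unfolding T_def k_def s_def using distinct by (intro isogonal_line_unit_iff unit) auto
  show "Im ((q - b) * (p - b) * cnj ((c - b) * (a - b))) = 0 \<longleftrightarrow> k * cnj T = b * T"
    unfolding T_def k(1) s(1) using distinct by (intro isogonal_line_unit_iff unit) auto
  show "Im ((q - c) * (p - c) * cnj ((a - c) * (b - c))) = 0 \<longleftrightarrow> k * cnj T = c * T"
    unfolding T_def k(2) s(2) using distinct by (intro isogonal_line_unit_iff unit) auto
qed

lemma dir_iff:
  fixes p d
  defines "T \<equiv> d + k * cnj p * cnj d"
  shows "Im (d * (p - a) * cnj ((b - a) * (c - a))) = 0 \<longleftrightarrow> k * cnj T = a * T"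
    and "Im (d * (p - b) * cnj ((c - b) * (a - b))) = 0 \<longleftrightarrow> k * cnj T = b * T"
    and "Im (d * (p - c) * cnj ((a - c) * (b - c))) = 0 \<longleftrightarrow> k * cnj T = c * T"
proof -
  have k: "k = b * c * a" "k = c * a * b"
    by (simp_all add: k_def)
  show "Im (d * (p - a) * cnj ((b - a) * (c - a))) = 0 \<longleftrightarrow> k * cnj T = a * T"
    unfolding T_def k_def using distinct by (intro isogonal_dir_unit_iff unit) auto
  show "Im (d * (p - b) * cnj ((c - b) * (a - b))) = 0 \<longleftrightarrow> k * cnj T = b * T"
    unfolding T_def k(1) using distinct by (intro isogonal_dir_unit_iff unit) auto
  show "Im (d * (p - c) * cnj ((a - c) * (b - c))) = 0 \<longleftrightarrow> k * cnj T = c * T"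
    unfolding T_def k(2) using distinct by (intro isogonal_dir_unit_iff unit) auto
qed

lemma vertex_multiples_iff: "k * cnj T = a * T \<and> k * cnj T = b * T \<and> k * cnj T = c * T \<longleftrightarrow> T = 0"
  using distinct by auto

lemma is_isogonal_conjugate_pt_iff:
  assumes "p \<notin> {a, b, c}"
  shows "is_isogonal_conjugate (pt a) (pt b) (pt c) (pt p) (pt q) \<longleftrightarrow> conjugates p q"
proof -
  let ?T = "p + q + k * cnj p * cnj q - s"
  have "is_isogonal_conjugate (pt a) (pt b) (pt c) (pt p) (pt q) \<longleftrightarrow>
    k * cnj ?T = a * ?T \<and> k * cnj ?T = b * ?T \<and> k * cnj ?T = c * ?T"
    using assms unfolding is_isogonal_conjugate_def
    by (simp only: mem_isogonal_line_iff(3) not_collinear not_collinear_rotate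
        Im_scaled_line line_iff pt_eq_iff insert_iff empty_iff de_Morgan_disj not_False_eq_True simp_thms)
  also have "\<dots> \<longleftrightarrow> ?T = 0"
    by (rule vertex_multiples_iff)
  finally show ?thesis
    by (simp add: conjugates_def)
qed

lemma is_isogonal_conjugate_at_infinity_pt_iff:
  assumes "p \<notin> {a, b, c}"
  shows "is_isogonal_conjugate_at_infinity (pt a) (pt b) (pt c) (pt p) d \<longleftrightarrow>
    d \<noteq> 0 \<and> d + k * cnj p * cnj d = 0"
proof -
  let ?T = "d + k * cnj p * cnj d"
  have "is_isogonal_conjugate_at_infinity (pt a) (pt b) (pt c) (pt p) d \<longleftrightarrow>
    d \<noteq> 0 \<and> k * cnj ?T = a * ?T \<and> k * cnj ?T = b * ?T \<and> k * cnj ?T = c * ?T"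
    using assms unfolding is_isogonal_conjugate_at_infinity_def collinear_0_complex_iff
    by (simp only: mem_isogonal_line_iff(2) not_collinear not_collinear_rotate
        Im_scaled_dir dir_iff pt_eq_iff insert_iff empty_iff de_Morgan_disj not_False_eq_True simp_thms)
  also have "k * cnj ?T = a * ?T \<and> k * cnj ?T = b * ?T \<and> k * cnj ?T = c * ?T \<longleftrightarrow> ?T = 0"
    by (rule vertex_multiples_iff)
  finally show ?thesis .
qed

lemma conjugates_imp_conj_num:
  assumes "conjugates p q"
  shows "q * (1 - p * cnj p) = conj_num p"
proof -
  have 1: "s - p = q + k * cnj p * cnj q"
    using assms by (simp add: conjugates_def algebra_simps)
  have "conj_num p = q + k * cnj p * cnj q - k * cnj p * (cnj q + cnj k * p * q)"
    unfolding conj_num_def 1 by simp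
  then show ?thesis
    using k_unit by algebra
qed

text \<open>On the unit circle the right-hand side vanishes, which makes \<open>conj_num p\<close> a
  solution of the equation for the conjugate at infinity. Off the circle the identity verifies that
  the quotient \<open>q\<close> is a conjugate.\<close>

lemma conj_num_direction: "conj_num p + k * cnj p * cnj (conj_num p) = (s - p) * (1 - p * cnj p)"
  unfolding conj_num_def complex_cnj_diff complex_cnj_mult complex_cnj_cnj using k_unit by algebra

lemma conj_num_imp_conjugates:
  assumes "q * (1 - p * cnj p) = conj_num p" "p * cnj p \<noteq> 1"
  shows "conjugates p q"
proof -
  have "cnj q * (1 - p * cnj p) = cnj (conj_num p)"
    unfolding assms(1)[symmetric] by simp
  moreover have "(p + q + k * cnj p * cnj q - s) * (1 - p * cnj p) =
    q * (1 - p * cnj p) + k * cnj p * (cnj q * (1 - p * cnj p)) - (s - p) * (1 - p * cnj p)"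
    by (simp add: algebra_simps)
  ultimately have "(p + q + k * cnj p * cnj q - s) * (1 - p * cnj p) = 0"
    using assms(1) conj_num_direction[of p] by simp
  then show ?thesis using assms(2) by (simp add: conjugates_def)
qed

lemma k_cnj_s: "k * cnj s = a * b + b * c + c * a"
  unfolding k_def s_def complex_cnj_add using unit by algebra

lemma conj_num_on_circle:
  assumes "p * cnj p = 1"
  shows "conj_num p = 0 \<longleftrightarrow> p \<in> {a, b, c}"
proof -
  \<comment> \<open>With \<open>cnj p = 1 / p\<close> the expression becomes minus the monic cubic
    polynomial whose roots are \<open>a\<close>, \<open>b\<close>, \<open>c\<close>.\<close>
  have "p * p * conj_num p = - ((p - a) * (p - b) * (p - c))"
    using assms k_cnj_s unfolding conj_num_def complex_cnj_diff
    by (simp only: k_def s_def) algebra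
  moreover have "p \<noteq> 0" using assms by auto
  ultimately show ?thesis by auto
qed

section \<open>Zeros and symmetry of the Darboux form\<close>

lemma darboux_form_self_conjugate: "conjugates p p \<Longrightarrow> darboux_form p = 0"
  using conjugates_imp_conj_num[of p p] by (simp add: darboux_form_def)

lemma darboux_form_vertex: "p \<in> {a, b, c} \<Longrightarrow> darboux_form p = 0"
  using unit conj_num_on_circle[of p] by (auto simp add: darboux_form_def simp del: times_complex.sel)

lemma darboux_form_expand:
  "darboux_form p = Im (3 * p * cnj s - p * p * cnj p * cnj s + k * cnj p * (cnj s)\<^sup>2 - k * cnj p ^ 3)"
proof -
  \<comment> \<open>\<open>X\<close> gathers terms with real sum; taking the imaginary part discards
    it and leaves only terms of odd degree in \<open>p\<close>. The coefficient 3 arises from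
    trading \<open>- s * cnj p\<close> for \<open>p * cnj s\<close>.\<close>
  define X where "X = 2 * (p * cnj p) - s * cnj s - (p * cnj p) * (p * cnj p) - (s * cnj p + p * cnj s)"
  have *: "(conj_num p - p * (1 - p * cnj p)) * cnj (- s - p) =
     (3 * p * cnj s - p * p * cnj p * cnj s + k * cnj p * (cnj s)\<^sup>2 - k * cnj p ^ 3) + X"
    unfolding conj_num_def complex_cnj_diff complex_cnj_minus X_def by algebra
  have "Im X = 0"
    unfolding X_def by simp
  then show ?thesis
    unfolding darboux_form_def * by (simp only: plus_complex.sel add_0_right)
qed

lemma darboux_form_minus: "darboux_form (- p) = - darboux_form p"
proof -
  have "3 * (- p) * cnj s - (- p) * (- p) * cnj (- p) * cnj s + k * cnj (- p) * (cnj s)\<^sup>2 - k * cnj (- p) ^ 3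
    = - (3 * p * cnj s - p * p * cnj p * cnj s + k * cnj p * (cnj s)\<^sup>2 - k * cnj p ^ 3)"
    unfolding complex_cnj_minus by algebra
  then show ?thesis
    unfolding darboux_form_expand by (simp only: uminus_complex.sel)
qed

section \<open>Circumcenter, orthocenter, de Longchamps point and the locus property\<close>

lemma circumcenter_pt: "circumcenter (pt a) (pt b) (pt c) = pt 0"
  using norm_one by (intro circumcenter_eqI not_collinear) (simp_all add: dist_pt)

lemma orthocenter_pt: "orthocenter (pt a) (pt b) (pt c) = pt s"
proof (rule orthocenter_eqI[OF not_collinear])
  \<comment> \<open>\<open>s - a = b + c\<close> is orthogonal to \<open>b - c\<close> because
    \<open>b\<close> and \<open>c\<close> have equal norm.\<close>
  have *: "(pt s - pt x) \<bullet> (pt y - pt z) = 0" if "s - x = y + z" "cmod y = 1" "cmod z = 1" for x y z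
  proof -
    have "(y + z) \<bullet> (y - z) = 0"
      using that by (simp add: algebra_simps dot_square_norm inner_commute)
    then show ?thesis
      unfolding pt_diff that(1) by (simp add: inner_complex_def) algebra
  qed
  show "(pt s - pt a) \<bullet> (pt b - pt c) = 0" "(pt s - pt b) \<bullet> (pt c - pt a) = 0"
    "(pt s - pt c) \<bullet> (pt a - pt b) = 0"
    by (rule *; simp add: s_def norm_one)+
qed

lemma de_longchamps_point_pt: "de_longchamps_point (pt a) (pt b) (pt c) = pt (- s)"
  unfolding de_longchamps_point_def circumcenter_pt orthocenter_pt by (simp add: pt_def)

text \<open>On the circumcircle there is no finite conjugate and \<open>conj_num p\<close> spans the
  direction at infinity; elsewhere there is exactly one finite conjugate and none at infinity. Each
  case uses one disjunct of the locus condition.\<close>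

lemma darboux_form_locus:
  assumes p: "p \<notin> {a, b, c}"
  shows "darboux_form p = 0 \<longleftrightarrow> collinear_with_isogonal_conjugate (pt a) (pt b) (pt c) (pt p) (pt (- s))"
proof -
  have finite: "(\<exists>Q. is_isogonal_conjugate (pt a) (pt b) (pt c) (pt p) Q \<and> collinear {pt p, Q, pt (- s)}) \<longleftrightarrow>
      (\<exists>q. conjugates p q \<and> Im ((q - p) * cnj (- s - p)) = 0)" (is "(\<exists>Q. ?R Q) \<longleftrightarrow> _")
  proof -
    have "(\<exists>Q. ?R Q) \<longleftrightarrow> (\<exists>q. ?R (pt q))"
      by (metis pt_cases)
    then show ?thesis
      by (simp only: is_isogonal_conjugate_pt_iff[OF p] collinear_pt_iff)
  qed
  have locus: "collinear_with_isogonal_conjugate (pt a) (pt b) (pt c) (pt p) (pt (- s)) \<longleftrightarrow>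
    (\<exists>q. conjugates p q \<and> Im ((q - p) * cnj (- s - p)) = 0) \<or>
    (\<exists>d. d \<noteq> 0 \<and> d + k * cnj p * cnj d = 0 \<and> Im (d * cnj (- s - p)) = 0)"
    unfolding collinear_with_isogonal_conjugate_def finite
      is_isogonal_conjugate_at_infinity_pt_iff[OF p] collinear_pt_dir_iff by simp
  let ?N = "conj_num p"
  show ?thesis
  proof (cases "p * cnj p = 1")
    case True
    have N: "?N \<noteq> 0" using conj_num_on_circle[OF True] p by simp
    have form: "darboux_form p = Im (?N * cnj (- s - p))"
      unfolding darboux_form_def True by simp
    have "\<not> conjugates p q" for q
      using conjugates_imp_conj_num[of p q] N True by auto
    moreover have "?N + k * cnj p * cnj ?N = 0"
      unfolding conj_num_direction True by simp
    moreover have "Im (?N * cnj (- s - p)) = 0"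
      if d: "d \<noteq> 0" "d + k * cnj p * cnj d = 0" "Im (d * cnj (- s - p)) = 0" for d
    proof -
      \<comment> \<open>Two solutions of \<open>d + k * cnj p * cnj d = 0\<close> are real multiples
        of each other, so the choice of \<open>d\<close> does not matter.\<close>
      have "?N * cnj d = cnj ?N * d"
        using d(2) \<open>?N + k * cnj p * cnj ?N = 0\<close> by algebra
      then have "Im (?N * cnj d) = 0"
        by (auto simp: complex_eq_iff algebra_simps)
      then obtain t where "?N = t *\<^sub>R d"
        using Im_mult_cnj_eq_0_iff[OF d(1)] by blast
      then have "?N * cnj (- s - p) = of_real t * (d * cnj (- s - p))"
        by (simp add: scaleR_conv_of_real)
      then show ?thesis
        using d(3) by (simp only: Im_of_real_mult mult_zero_right)
    qed
    ultimately show ?thesis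
      unfolding locus form using N by blast
  next
    case False
    define q where "q = ?N / (1 - p * cnj p)"
    have q: "q * (1 - p * cnj p) = ?N"
      using False by (simp add: q_def)
    have uniq: "conjugates p q' \<longleftrightarrow> q' = q" for q'
    proof
      assume "conjugates p q'"
      then have "(q' - q) * (1 - p * cnj p) = 0"
        using conjugates_imp_conj_num q by (simp add: left_diff_distrib del: mult_eq_0_iff)
      with False show "q' = q" by simp
    qed (use conj_num_imp_conjugates[OF q False] in simp)
    have "d = 0" if "d + k * cnj p * cnj d = 0" for d
    proof -
      have "cnj d + cnj k * p * d = 0"
        using arg_cong[OF that, of cnj] by simp
      with that k_unit have "d * (1 - p * cnj p) = 0" by algebra
      with False show ?thesis by simp
    qed
    then have "collinear_with_isogonal_conjugate (pt a) (pt b) (pt c) (pt p) (pt (- s)) \<longleftrightarrow>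
        Im ((q - p) * cnj (- s - p)) = 0"
      unfolding locus uniq by blast
    moreover have "darboux_form p = (1 - (cmod p)\<^sup>2) * Im ((q - p) * cnj (- s - p))"
    proof -
      have w: "1 - p * cnj p = of_real (1 - (cmod p)\<^sup>2)"
        using complex_norm_square[of p] by simp
      have "(?N - p * (1 - p * cnj p)) * cnj (- s - p) = (1 - p * cnj p) * ((q - p) * cnj (- s - p))"
        unfolding q[symmetric] by algebra
      then show ?thesis
        unfolding darboux_form_def w by (simp only: Im_of_real_mult)
    qed
    moreover have "(cmod p)\<^sup>2 \<noteq> 1"
      using False by (metis complex_norm_square of_real_1 of_real_power)
    ultimately show ?thesis by simp
  qed
qed

section \<open>Incenter, excenters and Bevan point\<close>

text \<open>A point on a bisector lies on its own isogonal line. Two vertices suffice, since the two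
  conditions on \<open>T\<close> give \<open>(a - b) * T = 0\<close>.\<close>

lemma self_conjugateI:
  assumes "pt p \<in> internal_bisector (pt a) (pt b) (pt c) \<or> pt p \<in> external_bisector (pt a) (pt b) (pt c)"
    and "pt p \<in> internal_bisector (pt b) (pt c) (pt a) \<or> pt p \<in> external_bisector (pt b) (pt c) (pt a)"
  shows "conjugates p p"
proof -
  let ?T = "p + p + k * cnj p * cnj p - s"
  have "Im ((pt p - pt a) * (pt p - pt a) * cnj ((pt b - pt a) * (pt c - pt a))) = 0"
    "Im ((pt p - pt b) * (pt p - pt b) * cnj ((pt c - pt b) * (pt a - pt b))) = 0"
    unfolding power2_eq_square[symmetric]
      Im_square_cnj_bisector[OF not_collinear] Im_square_cnj_bisector[OF not_collinear_rotate(1)]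
    using assms by (simp_all only: mem_internal_bisector_iff[OF not_collinear]
        mem_internal_bisector_iff[OF not_collinear_rotate(1)] mem_external_bisector_iff)
  then have "k * cnj ?T = a * ?T" "k * cnj ?T = b * ?T"
    unfolding Im_scaled_line line_iff by blast+
  then have "(a - b) * ?T = 0"
    by (simp only: left_diff_distrib) simp
  then show ?thesis
    using distinct by (auto simp: conjugates_def)
qed

text \<open>For the incenter and an excenter this says that the excenter has distance \<open>2 * r\<close> from the
  reflection of the incenter in the circumcenter, which is therefore the Bevan point.\<close>

lemma self_conjugate_pair:
  assumes "conjugates p p" "conjugates q q" "p \<noteq> q"
  shows "cmod (p + q) = 2"
proof -
  have "2 * p + k * cnj p * cnj p = 2 * q + k * cnj q * cnj q"
    using assms(1,2) by (simp add: conjugates_def)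
  then have "2 * (p - q) = - (k * cnj (p - q) * cnj (p + q))"
    unfolding complex_cnj_add complex_cnj_diff by algebra
  then have "cmod (2 * (p - q)) = cmod (k * cnj (p - q) * cnj (p + q))"
    by (metis norm_minus_cancel)
  moreover have "cmod k = 1"
    using norm_one by (simp add: k_def norm_mult)
  ultimately show ?thesis
    using assms(3) by (simp only: norm_mult complex_mod_cnj) simp
qed

lemma centers:
  obtains i j1 j2 j3 where
    "incenter (pt a) (pt b) (pt c) = pt i"
    "excenter (pt a) (pt b) (pt c) = pt j1" "excenter (pt b) (pt c) (pt a) = pt j2"
    "excenter (pt c) (pt a) (pt b) = pt j3"
    "conjugates i i" "conjugates j1 j1" "conjugates j2 j2" "conjugates j3 j3"
    "bevan_point (pt a) (pt b) (pt c) = pt (- i)"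
proof -
  let ?I1 = "internal_bisector (pt a) (pt b) (pt c)" and ?E1 = "external_bisector (pt a) (pt b) (pt c)"
  let ?I2 = "internal_bisector (pt b) (pt c) (pt a)" and ?E2 = "external_bisector (pt b) (pt c) (pt a)"
  let ?I3 = "internal_bisector (pt c) (pt a) (pt b)" and ?E3 = "external_bisector (pt c) (pt a) (pt b)"
  obtain i where i: "incenter (pt a) (pt b) (pt c) = pt i" by (rule pt_cases)
  obtain j1 where j1: "excenter (pt a) (pt b) (pt c) = pt j1" by (rule pt_cases)
  obtain j2 where j2: "excenter (pt b) (pt c) (pt a) = pt j2" by (rule pt_cases)
  obtain j3 where j3: "excenter (pt c) (pt a) (pt b) = pt j3" by (rule pt_cases)
  have I: "pt i \<in> ?I1" "pt i \<in> ?I2" "pt i \<in> ?I3"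
    using incenter_mem[OF not_collinear] by (simp_all add: i)
  have J1: "pt j1 \<in> ?I1" "pt j1 \<in> ?E2" "pt j1 \<in> ?E3"
    using excenter_mem[OF not_collinear] by (simp_all add: j1)
  have J2: "pt j2 \<in> ?I2" "pt j2 \<in> ?E3" "pt j2 \<in> ?E1"
    using excenter_mem[OF not_collinear_rotate(1)] by (simp_all add: j2)
  have J3: "pt j3 \<in> ?I3" "pt j3 \<in> ?E1" "pt j3 \<in> ?E2"
    using excenter_mem[OF not_collinear_rotate(2)] by (simp_all add: j3)
  have conj: "conjugates i i" "conjugates j1 j1" "conjugates j2 j2" "conjugates j3 j3"
    using I J1 J2 J3 by (blast intro: self_conjugateI)+
  have I1E1: "x = a" if "pt x \<in> ?I1" "pt x \<in> ?E1" for x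
    using bisectors_meet_at_vertex[OF not_collinear that] by simp
  have I2E2: "x = b" if "pt x \<in> ?I2" "pt x \<in> ?E2" for x
    using bisectors_meet_at_vertex[OF not_collinear_rotate(1) that] by simp
  have I3E3: "x = c" if "pt x \<in> ?I3" "pt x \<in> ?E3" for x
    using bisectors_meet_at_vertex[OF not_collinear_rotate(2) that] by simp
  \<comment> \<open>If two of these centers coincided, the common point would lie on both bisectors
    at each of two vertices and so equal both of them.\<close>
  have ne: "i \<noteq> j1" "i \<noteq> j2" "i \<noteq> j3" "j1 \<noteq> j2" "j2 \<noteq> j3" "j3 \<noteq> j1"
    using distinct I1E1[of i] I2E2[of i] I3E3[of i] I1E1[of j1] I2E2[of j1] I3E3[of j1]
      I2E2[of j2] I3E3[of j2] I J1 J2 J3 by auto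
  have "dist (pt (- i)) (pt j) = r * 2" if "conjugates j j" "i \<noteq> j" for j
  proof -
    have "- i - j = - (i + j)" by simp
    then show ?thesis
      using self_conjugate_pair[OF conj(1) that] unfolding dist_pt
      unfolding dist_norm by (simp only: norm_minus_cancel)
  qed
  with conj ne have d: "dist (pt (- i)) (pt j1) = r * 2" "dist (pt (- i)) (pt j2) = r * 2"
    "dist (pt (- i)) (pt j3) = r * 2"
    by blast+
  have "bevan_point (pt a) (pt b) (pt c) = pt (- i)"
    unfolding bevan_point_def j1 j2 j3
    by (intro circumcenter_eqI concyclic_not_collinear[of "pt (- i)"]) (use d ne in simp_all)
  with i j1 j2 j3 conj show thesis by (rule that)
qed

section \<open>The zero set of the Darboux form is the Darboux cubic\<close>

lemma cubic_curve_darboux_set: "cubic_curve darboux_set"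
proof -
  define w where "w = k * (cnj s)\<^sup>2"
  have "darboux_form p = (Im s - Im k) * Re p ^ 3 + (3 * Re k - Re s) * (Re p)\<^sup>2 * Im p
      + (Im s + 3 * Im k) * Re p * (Im p)\<^sup>2 + (- Re s - Re k) * Im p ^ 3
      + (Im w - 3 * Im s) * Re p + (3 * Re s - Re w) * Im p" for p
  proof -
    have *: "k * cnj p * (cnj s)\<^sup>2 = w * cnj p"
      by (simp add: w_def)
    show ?thesis
      unfolding darboux_form_expand * by (simp add: power3_eq_cube power2_eq_square algebra_simps)
  qed
  \<comment> \<open>If all four leading coefficients vanished, their real and imaginary parts would
    force \<open>k = 0\<close>, although \<open>k\<close> has norm one.\<close>
  moreover have "Im s - Im k \<noteq> 0 \<or> 3 * Re k - Re s \<noteq> 0 \<or> Im s + 3 * Im k \<noteq> 0 \<or> - Re s - Re k \<noteq> 0"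
  proof (rule ccontr)
    assume "\<not> ?thesis"
    then have "k = 0" by (simp add: complex_eq_iff)
    then show False using k_unit by simp
  qed
  moreover have "r \<noteq> 0"
    using radius_pos by simp
  ultimately have "cubic_curve ((\<lambda>p. m + of_real r * p) ` {p. darboux_form p = 0})"
    by (intro cubic_curve_affine_image)
  then show ?thesis
    by (simp add: darboux_set_def pt_def)
qed

text \<open>Incenter and excenters are self-conjugate zeros of the form; the Bevan point is the
  incenter reflected in the circumcenter, so oddness covers it.\<close>

lemma is_darboux_cubic_darboux_set: "is_darboux_cubic darboux_set (pt a) (pt b) (pt c)"
proof -
  obtain i j1 j2 j3 where
    eqs: "incenter (pt a) (pt b) (pt c) = pt i"
    "excenter (pt a) (pt b) (pt c) = pt j1" "excenter (pt b) (pt c) (pt a) = pt j2"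
    "excenter (pt c) (pt a) (pt b) = pt j3" "bevan_point (pt a) (pt b) (pt c) = pt (- i)"
    and conj: "conjugates i i" "conjugates j1 j1" "conjugates j2 j2" "conjugates j3 j3"
    by (rule centers)
  have locus: "P \<in> darboux_set \<longleftrightarrow> collinear_with_isogonal_conjugate (pt a) (pt b) (pt c) P (pt (- s))"
    if "P \<notin> {pt a, pt b, pt c}" for P
  proof -
    obtain p where P: "P = pt p" by (rule pt_cases)
    then show ?thesis
      using that darboux_form_locus[of p] by (simp add: pt_in_darboux_set_iff)
  qed
  have "darboux_form 0 = 0"
    by (simp add: darboux_form_expand)
  with conj show ?thesis
    unfolding is_darboux_cubic_def eqs circumcenter_pt de_longchamps_point_pt
    by (simp add: cubic_curve_darboux_set locus pt_in_darboux_set_iff darboux_form_vertex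
        darboux_form_self_conjugate darboux_form_minus)
qed

end

section \<open>Transfer to the Euler triangle\<close>

theorem theorem7:
  fixes A B C :: complex and K :: "complex set"
  assumes triangle: "\<not> collinear {A, B, C}"
    and K: "K = darboux_cubic (euler_vertex A B C) (euler_vertex B C A) (euler_vertex C A B)"
  shows "circumcenter A B C \<in> K \<and>
    orthocenter A B C \<in> K \<and>
    nine_point_center A B C \<in> K \<and>
    midpoint (incenter A B C) (orthocenter A B C) \<in> K \<and>
    {euler_vertex A B C, euler_vertex B C A, euler_vertex C A B} \<subseteq> K \<and>
    {midpoint B C, midpoint C A, midpoint A B} \<subseteq> K"
proof -
  note ne = noncollinear_distinct[OF triangle]
  obtain m where m: "dist m A = dist m B" "dist m B = dist m C"
    by (rule circumcenter_exists[OF triangle])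
  define r where "r = dist m A"
  have r: "r > 0" "cmod (A - m) = r" "cmod (B - m) = r" "cmod (C - m) = r"
    using m ne by (auto simp: r_def dist_norm norm_minus_commute)
  define a b c where "a = (A - m) / of_real r" and "b = (B - m) / of_real r" and "c = (C - m) / of_real r"
  interpret T: circle_triangle m r a b c
    using r ne by unfold_locales (auto simp: a_def b_def c_def norm_divide)
  \<comment> \<open>\<open>n\<close> is the midpoint of circumcenter and orthocenter, so
    \<open>E.pt\<close> is \<open>T.pt\<close> followed by the homothety of ratio one half at the
    orthocenter.\<close>
  define n r' where "n = m + of_real (r / 2) * T.s" and "r' = r / 2"
  interpret E: circle_triangle n r' a b c
    using r T.norm_one T.distinct by unfold_locales (auto simp: r'_def)
  have ABC: "A = T.pt a" "B = T.pt b" "C = T.pt c"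
    using r by (simp_all add: T.pt_def a_def b_def c_def)
  have ort: "orthocenter A B C = T.pt T.s" "orthocenter B C A = T.pt T.s" "orthocenter C A B = T.pt T.s"
    unfolding T.orthocenter_pt[symmetric] ABC by (simp_all add: orthocenter_def conj_ac)
  have mid_H: "midpoint (T.pt p) (T.pt T.s) = E.pt p" for p
    unfolding T.pt_def E.pt_def unfolding n_def r'_def by (simp add: midpoint_def scaleR_conv_of_real field_simps)
  have eul: "euler_vertex A B C = E.pt a" "euler_vertex B C A = E.pt b" "euler_vertex C A B = E.pt c"
    unfolding euler_vertex_def ort unfolding ABC mid_H by simp_all
  have K': "K = E.darboux_set"
    unfolding K eul by (rule darboux_cubic_eqI[OF E.is_darboux_cubic_darboux_set])
  \<comment> \<open>Since \<open>b + c = s - a\<close>, the midpoint of a side is opposite to an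
    Euler vertex on the circle about \<open>n\<close>.\<close>
  have mids: "midpoint B C = E.pt (- a)" "midpoint C A = E.pt (- b)" "midpoint A B = E.pt (- c)"
    unfolding ABC T.pt_def E.pt_def unfolding n_def r'_def T.s_def
    by (simp_all add: midpoint_def scaleR_conv_of_real field_simps)
  have nine: "nine_point_center A B C = E.pt 0"
    unfolding nine_point_center_def mids
    by (intro circumcenter_eqI concyclic_not_collinear[of "E.pt 0"])
      (use T.norm_one T.distinct in \<open>simp_all add: E.dist_pt\<close>)
  have "circumcenter A B C = T.pt 0"
    unfolding ABC by (rule T.circumcenter_pt)
  also have "\<dots> = E.pt (- T.s)"
    unfolding T.pt_def E.pt_def unfolding n_def r'_def by simp
  finally have cir: "circumcenter A B C = E.pt (- T.s)" .
  have "orthocenter A B C = E.pt T.s"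
    unfolding ort mid_H[symmetric] by simp
  \<comment> \<open>The relation \<open>conjugates\<close> depends only on \<open>a\<close>,
    \<open>b\<close>, \<open>c\<close>, so self-conjugacy of \<open>i\<close> for the original
    triangle carries over to the Euler triangle.\<close>
  obtain i where i: "incenter A B C = T.pt i" "T.conjugates i i"
    unfolding ABC by (rule T.centers)
  have inc: "midpoint (incenter A B C) (orthocenter A B C) = E.pt i"
    unfolding i ort mid_H ..
  \<comment> \<open>At \<open>- T.s\<close> the factor \<open>cnj (- s - p)\<close> vanishes; the
    orthocenter, at \<open>T.s\<close>, then follows by oddness.\<close>
  have zero: "E.darboux_form 0 = 0" "E.darboux_form (- T.s) = 0"
    by (simp add: E.darboux_form_expand) (simp add: E.darboux_form_def)
  show ?thesis
    unfolding K' cir nine inc eul mids unfolding \<open>orthocenter A B C = E.pt T.s\<close>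
    using zero E.darboux_form_self_conjugate[OF i(2)]
    by (simp add: E.pt_in_darboux_set_iff E.darboux_form_vertex E.darboux_form_minus)
qed

end
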